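(* Assume the standing assumptions on $F$. Consider SVRC under sampling without replacement, fix an iteration $k$ with $k\bmod m\ne0$, and condition on all randomness up to the computation of $x_k$ (so $x_k$, $\tilde x$, $s_k$ are fixed). Let $\zeta\in(0,1)$. If $$|\xi_g(k)|\ge\Big(\frac1N+\frac{\beta^2\max\{\|s_k\|^4,\epsilon_1^4\}}{64L_1^2\|x_k-\tilde x\|^2\log(2(d+1)/\zeta)}\Big)^{-1},$$ then with probability at least $1-\zeta$, $\|g_k-\nabla F(x_k)\|\le\beta\max\{\|s_k\|^2,\epsilon_1^2\}$. If $$|\xi_H(k)|\ge\Big(\frac1N+\frac{\alpha^2\max\{\|s_k\|^2,\epsilon_1^2\}}{64L_2^2\|x_k-\tilde x\|^2\log(4d/\zeta)}\Big)^{-1},$$ then with probability at least $1-\zeta$, $\|H_k-\nabla^2F(x_k)\|\le\alpha\max\{\|s_k\|,\epsilon_1\}$.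
   Context: Objective: $F(x)=\frac1N\sum_{i=1}^N f_i(x)$ on $\mathbb{R}^d$, each $f_i$ twice differentiable. Standing assumptions: $F^*\triangleq\inf_x F(x)>-\infty$; for every $i$, $f_i$, $\nabla f_i$ and $\nabla^2 f_i$ are Lipschitz with constants $L_0$, $L_1$, $L_2$ respectively (Hessian differences measured in spectral norm). All matrix norms are spectral norms. SVRC iteration with parameters $x_0\in\mathbb{R}^d$, $\epsilon_1>0$, integer $m\ge1$, $M>0$: for $k=0,1,2,\dots$: if $k\bmod m=0$, set $g_k=\nabla F(x_k)$, $H_k=\nabla^2F(x_k)$ and set the reference quantities $\tilde x=x_k$, $\tilde g=g_k$, $\tilde H=H_k$; otherwise draw index collections $\xi_g(k),\xi_H(k)\subseteq\{1,\dots,N\}$ at random and set $g_k=\frac1{|\xi_g(k)|}\sum_{i\in\xi_g(k)}(\nabla f_i(x_k)-\nabla f_i(\tilde x))+\tilde g$, $H_k=\frac1{|\xi_H(k)|}\sum_{i\in\xi_H(k)}(\nabla^2 f_i(x_k)-\nabla^2 f_i(\tilde x))+\tilde H$. Then $s_{k+1}$ is a global minimizer of $s\mapsto g_k^\top s+\frac12 s^\top H_k s+\frac M6\|s\|^3$, $x_{k+1}=x_k+s_{k+1}$, and the algorithm stops and returns $x_{k+1}$ if $\max\{\|s_{k+1}\|,\|s_k\|\}\le\epsilon_1$. By convention $s_0$ is a vector with $\|s_0\|=\epsilon_1$. Sampling without replacement: $\xi_g(k)$ and $\xi_H(k)$ are drawn uniformly at random among all subsets of $\{1,\dots,N\}$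 of the prescribed cardinalities (cardinalities less than $N$). Here $\alpha,\beta>0$ are fixed constants. *)

theory Defs
  imports "HOL-Analysis.Analysis" "HOL-Probability.Probability"
begin

definition spec_norm :: "real^'n^'n \<Rightarrow> real" where
  "spec_norm A = onorm (\<lambda>v. A *v v)"

definition avg_vec :: "nat \<Rightarrow> (nat \<Rightarrow> 'a \<Rightarrow> 'b::real_vector) \<Rightarrow> 'a \<Rightarrow> 'b" where
  "avg_vec N h x = (1 / real N) *\<^sub>R (\<Sum>i<N. h i x)"

text \<open>Subsampled variance-reduced estimator:
  (1/|S|) sum_{i in S} (h_i(x) - h_i(xt)) + ht, with ht the full average at the reference point.\<close>
definition vr_est :: "(nat \<Rightarrow> 'a \<Rightarrow> 'b::real_vector) \<Rightarrow> nat set \<Rightarrow> 'a \<Rightarrow> 'a \<Rightarrow> 'b \<Rightarrow> 'b" where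
  "vr_est h S x xt ht = (1 / real (card S)) *\<^sub>R (\<Sum>i\<in>S. (h i x - h i xt)) + ht"

definition subset_sample :: "nat \<Rightarrow> nat \<Rightarrow> nat set pmf" where
  "subset_sample N b = pmf_of_set {S. S \<subseteq> {0..<N} \<and> card S = b}"

end

theory Submission
  imports Defs
begin

text \<open>For symmetric matrices \<open>a\<^sub>i\<close> and a uniform sample \<open>S\<close> of size \<open>b\<close>, put
  \<open>X = (\<Sum>i\<in>S. a\<^sub>i) - (b/N) (\<Sum>i<N. a\<^sub>i)\<close>. Then \<open>N X\<close> is the sum of \<open>a\<^sub>i - a\<^sub>j\<close> over \<open>i \<in> S\<close>,
  \<open>j \<notin> S\<close>, and exchanging \<open>i\<close> with \<open>j\<close> preserves the distribution of \<open>S\<close> while changing \<open>X\<close> by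
  \<open>a\<^sub>i - a\<^sub>j\<close>. This exchangeable-pair identity, with a mean value inequality for the trace, bounds
  \<open>E tr X\<^bsup>2n+2\<^esup>\<close> by \<open>(2n+1) V E tr X\<^bsup>2n\<^esup>\<close> where \<open>V\<close> is proportional to \<open>b (N - b) / N\<close>; hence the factor
  \<open>1/b - 1/N\<close> in the exponent. Iterating gives a Gaussian tail for \<open>X\<close>. Rectangular matrices reduce to
  symmetric ones by Hermitian dilation, which yields dimension \<open>2d\<close> for Hessians and \<open>d + 1\<close> for
  gradients, viewed as column matrices.\<close>

subsection \<open>Frobenius inner product and powers of matrices\<close>

primrec matrix_power :: "real^'n^'n \<Rightarrow> nat \<Rightarrow> real^'n^'n" where
  "matrix_power A 0 = mat 1"
| "matrix_power A (Suc k) = A ** matrix_power A k"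

lemma matrix_power_add: "matrix_power A (j + k) = matrix_power A j ** matrix_power A k"
  by (induction j) (simp_all add: matrix_mul_assoc)

lemma matrix_power_Suc_right: "matrix_power A (Suc k) = matrix_power A k ** A"
  using matrix_power_add[of A k 1] by simp

lemma transpose_matrix_power:
  assumes "transpose A = A"
  shows "transpose (matrix_power A k) = matrix_power A k"
proof (induction k)
  case (Suc k)
  then show ?case
    by (metis assms matrix_power.simps(2) matrix_power_Suc_right matrix_transpose_mul)
qed simp

text \<open>The inner product on matrices is the Frobenius product tr(A^T B). Moving factors across
  it replaces every use of the trace: for symmetric \<open>X\<close>, tr X^(2n) appears as the
  squared norm of \<open>matrix_power X n\<close>.\<close>

lemma inner_matrix_mul_left:
  fixes A :: "real^'m^'k" and B :: "real^'n^'m"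
  shows "(A ** B) \<bullet> C = B \<bullet> (transpose A ** C)"
proof -
  have "(A ** B) \<bullet> C = (\<Sum>i\<in>UNIV. \<Sum>j\<in>UNIV. \<Sum>l\<in>UNIV. A$i$l * B$l$j * C$i$j)"
    by (simp add: inner_vec_def matrix_matrix_mult_def sum_distrib_right)
  also have "\<dots> = (\<Sum>l\<in>UNIV. \<Sum>j\<in>UNIV. \<Sum>i\<in>UNIV. A$i$l * B$l$j * C$i$j)"
    by (subst sum.swap, subst (2) sum.swap, subst (1) sum.swap) (rule refl)
  also have "\<dots> = B \<bullet> (transpose A ** C)"
    by (simp add: inner_vec_def matrix_matrix_mult_def transpose_def sum_distrib_left mult_ac)
  finally show ?thesis .
qed

lemma inner_transpose: "transpose A \<bullet> transpose B = A \<bullet> (B :: real^'n^'m)"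
  by (simp add: inner_vec_def transpose_def) (rule sum.swap)

lemma norm_transpose: "norm (transpose A) = norm (A :: real^'n^'m)"
  by (simp add: norm_eq_sqrt_inner inner_transpose)

lemma inner_matrix_mul_right:
  fixes A :: "real^'m^'k" and B :: "real^'n^'m"
  shows "(A ** B) \<bullet> C = A \<bullet> (C ** transpose B)"
proof -
  have "(A ** B) \<bullet> C = (transpose B ** transpose A) \<bullet> transpose C"
    by (metis inner_transpose matrix_transpose_mul)
  also have "\<dots> = transpose A \<bullet> (B ** transpose C)"
    by (simp add: inner_matrix_mul_left transpose_transpose)
  also have "\<dots> = A \<bullet> (C ** transpose B)"
    by (metis inner_transpose matrix_transpose_mul transpose_transpose)
  finally show ?thesis .
qed

text \<open>The squared Frobenius norm is the sum of the squared norms of the columns, and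
  \<open>A\<close> acts on each column separately.\<close>

lemma norm_matrix_mul_le:
  fixes A :: "real^'m^'k" and B :: "real^'n^'m"
  assumes "\<And>v. norm (A *v v) \<le> R * norm v"
  shows "(norm (A ** B))\<^sup>2 \<le> R\<^sup>2 * (norm B)\<^sup>2"
proof -
  have sq: "(norm C)\<^sup>2 = (\<Sum>j\<in>UNIV. (norm (column j C))\<^sup>2)" for C :: "real^'n^'p"
  proof -
    have "(norm C)\<^sup>2 = transpose C \<bullet> transpose C"
      by (simp add: power2_norm_eq_inner inner_transpose)
    also have "\<dots> = (\<Sum>j\<in>UNIV. (norm (column j C))\<^sup>2)"
      by (subst inner_vec_def) (simp add: power2_norm_eq_inner column_def transpose_def)
    finally show ?thesis .
  qed
  have "column j (A ** B) = A *v column j B" for j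
    by (simp add: vec_eq_iff column_def matrix_matrix_mult_def matrix_vector_mult_def)
  then have "(norm (A ** B))\<^sup>2 = (\<Sum>j\<in>UNIV. (norm (A *v column j B))\<^sup>2)"
    by (simp add: sq)
  also have "\<dots> \<le> (\<Sum>j\<in>UNIV. (R * norm (column j B))\<^sup>2)"
    by (intro sum_mono power_mono assms) auto
  also have "\<dots> = R\<^sup>2 * (norm B)\<^sup>2"
    by (simp add: sq power_mult_distrib sum_distrib_left)
  finally show ?thesis .
qed

lemma norm_matrix_mul_symmetric_le:
  fixes A :: "real^'n^'n" and B :: "real^'n^'m"
  assumes "\<And>v. norm (A *v v) \<le> R * norm v" and "transpose A = A"
  shows "(norm (B ** A))\<^sup>2 \<le> R\<^sup>2 * (norm B)\<^sup>2"
  using norm_matrix_mul_le[OF assms(1), of "transpose B"]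
  by (metis assms(2) matrix_transpose_mul norm_transpose)

lemma norm_matrix_vector_mul_le: "norm (A *v v) \<le> norm A * norm (v :: real^'n)"
  for A :: "real^'n^'m"
proof -
  have "(norm (A *v v))\<^sup>2 = (\<Sum>i\<in>UNIV. (A $ i \<bullet> v)\<^sup>2)"
    unfolding power2_norm_eq_inner
    by (subst inner_vec_def) (simp add: matrix_vector_mul_component power2_eq_square)
  also have "\<dots> \<le> (\<Sum>i\<in>UNIV. (norm (A $ i))\<^sup>2 * (norm v)\<^sup>2)"
    using Cauchy_Schwarz_ineq by (intro sum_mono) (auto simp: power2_norm_eq_inner)
  also have "\<dots> = (norm A * norm v)\<^sup>2"
    unfolding power_mult_distrib power2_norm_eq_inner inner_vec_def[of A] sum_distrib_right ..
  finally show ?thesis by (rule power2_le_imp_le) simp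
qed

text \<open>This links the operator norm to the moments without eigenvalues. By symmetry and
  Cauchy-Schwarz the sequence |A^k v| is log-convex, so its successive ratios never fall below the
  first one, |A v|.\<close>

lemma norm_power_le_norm_matrix_power:
  fixes A :: "real^'n^'n"
  assumes sym: "transpose A = A" and v: "norm v = 1"
  shows "norm (A *v v) ^ k \<le> norm (matrix_power A k)"
proof -
  define a where "a k = norm (matrix_power A k *v v)" for k
  have inner: "(A *v x) \<bullet> y = x \<bullet> (A *v y)" for x y
    using dot_lmul_matrix[of x A y] sym by (metis inner_commute transpose_matrix_vector)
  have a0: "a 0 = 1" and a1: "a 1 = norm (A *v v)"
    using v by (simp_all add: a_def)
  have log_convex: "(a (Suc k))\<^sup>2 \<le> a k * a (Suc (Suc k))" for k
  proof -
    have "(a (Suc k))\<^sup>2 = (matrix_power A k *v v) \<bullet> (matrix_power A (Suc (Suc k)) *v v)"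
      by (simp add: a_def power2_norm_eq_inner inner flip: matrix_vector_mul_assoc)
    also have "\<dots> \<le> a k * a (Suc (Suc k))"
      unfolding a_def by (rule norm_cauchy_schwarz)
    finally show ?thesis .
  qed
  have step: "a 1 * a k \<le> a (Suc k)" for k
  proof (induction k)
    case (Suc k)
    show ?case
    \<comment> \<open>A vanishing \<open>a k\<close> rules out cancelling it, but log-convexity then
      makes \<open>a (Suc k)\<close> vanish too.\<close>
    proof (cases "a k = 0")
      case True
      with log_convex[of k] have "a (Suc k) = 0" by simp
      then show ?thesis by (simp add: a_def)
    next
      case False
      then have pos: "a k > 0" by (simp add: a_def)
      have "a k * (a 1 * a (Suc k)) \<le> a (Suc k) * a (Suc k)"
        using mult_right_mono[OF Suc.IH, of "a (Suc k)"] by (simp add: a_def mult_ac)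
      also have "\<dots> \<le> a k * a (Suc (Suc k))"
        using log_convex[of k] by (simp add: power2_eq_square)
      finally show ?thesis using pos by simp
    qed
  qed (simp add: a0)
  have "a 1 ^ k \<le> a k"
  proof (induction k)
    case (Suc k)
    have "a 1 ^ Suc k \<le> a 1 * a k"
      using Suc by (simp add: mult_left_mono a_def)
    with step[of k] show ?case by simp
  qed (simp add: a0)
  also have "a k \<le> norm (matrix_power A k)"
    using norm_matrix_vector_mul_le[of "matrix_power A k" v] v by (simp add: a_def)
  finally show ?thesis by (simp only: a1)
qed

section \<open>Mean value inequality for odd matrix powers\<close>

text \<open>Discrete maximum principle: at the least index attaining an interior maximum, the left
  neighbour is strictly smaller and the right one no larger, which contradicts midpoint
  convexity.\<close>

lemma convex_seq_le_endpoints: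
  fixes g :: "nat \<Rightarrow> real"
  assumes convex: "\<And>a. 0 < a \<Longrightarrow> a < n \<Longrightarrow> 2 * g a \<le> g (a - 1) + g (a + 1)" and "a \<le> n"
  shows "g a \<le> max (g 0) (g n)"
proof (rule ccontr)
  assume neg: "\<not> ?thesis"
  define M where "M = Max (g ` {..n})"
  have le: "g b \<le> M" if "b \<le> n" for b using that by (simp add: M_def)
  have "M \<in> g ` {..n}" unfolding M_def by (rule Max_in) auto
  then have ex: "\<exists>b. b \<le> n \<and> g b = M" by auto
  define b where "b = (LEAST b. b \<le> n \<and> g b = M)"
  have b: "b \<le> n" "g b = M" using LeastI_ex[OF ex] by (auto simp: b_def)
  have "M > g 0" "M > g n" using neg le[OF \<open>a \<le> n\<close>] by auto
  with b have b': "0 < b" "b < n" by (auto intro: gr0I simp: le_less)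
  have "g (b - 1) \<noteq> M"
    using not_less_Least[of "b - 1" "\<lambda>b. b \<le> n \<and> g b = M"] b' by (auto simp: b_def)
  moreover have "g (b - 1) \<le> M" by (rule le) (use b' in simp)
  ultimately have "g (b - 1) < M" by simp
  with convex[OF b'] le[of "b + 1"] b b' show False by simp
qed

lemma linear_matrix_mul_left: "linear (\<lambda>A :: real^'m^'k. A ** (B :: real^'n^'m))"
  by (rule linearI) (simp_all add: vec_eq_iff matrix_matrix_mult_def distrib_right sum.distrib
      sum_distrib_left mult.assoc)

lemma linear_matrix_mul_right: "linear (\<lambda>B :: real^'n^'m. (A :: real^'m^'k) ** B)"
  by (rule linearI) (simp_all add: vec_eq_iff matrix_matrix_mult_def distrib_left sum.distrib
      sum_distrib_left mult.left_commute)

text \<open>Noncommutative form of the factorisation of x^m - y^m: the factors \<open>X\<close> are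
  replaced by \<open>Y\<close> one at a time and the differences telescope.\<close>

lemma matrix_power_diff:
  "matrix_power X m - matrix_power Y m =
    (\<Sum>q<m. matrix_power X q ** (X - Y) ** matrix_power Y (m - 1 - q))"
proof (induction m)
  case (Suc m)
  have "matrix_power X (Suc m) - matrix_power Y (Suc m) =
      matrix_power X m ** (X - Y) + (matrix_power X m - matrix_power Y m) ** Y"
    by (simp only: matrix_power_Suc_right linear_diff[OF linear_matrix_mul_left]
        linear_diff[OF linear_matrix_mul_right]) simp
  also have "(matrix_power X m - matrix_power Y m) ** Y =
      (\<Sum>q<m. matrix_power X q ** (X - Y) ** matrix_power Y (m - 1 - q) ** Y)"
    unfolding Suc.IH by (rule linear_sum[OF linear_matrix_mul_left])
  also have "\<dots> = (\<Sum>q<m. matrix_power X q ** (X - Y) ** matrix_power Y (m - q))"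
  proof (intro sum.cong refl)
    fix q assume "q \<in> {..<m}"
    then have "m - q = Suc (m - 1 - q)" by auto
    then show "matrix_power X q ** (X - Y) ** matrix_power Y (m - 1 - q) ** Y =
        matrix_power X q ** (X - Y) ** matrix_power Y (m - q)"
      by (metis matrix_power_Suc_right matrix_mul_assoc)
  qed
  finally show ?case by simp
qed simp


text \<open>The squared norms of \<^term>\<open>matrix_power X a ** D ** matrix_power Y (n - a)\<close> are convex in
  \<^term>\<open>a\<close> by Cauchy-Schwarz; this replaces the spectral theorem in the usual proof.\<close>

lemma inner_sandwich_le:
  fixes X Y D :: "real^'n^'n"
  assumes sym: "transpose X = X" "transpose Y = Y" "transpose D = D"
    and bound: "\<And>v. norm (D *v v) \<le> R * norm v" and "q \<le> 2 * n"
  shows "D \<bullet> (matrix_power X q ** D ** matrix_power Y (2 * n - q)) \<le>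
    R\<^sup>2 * ((norm (matrix_power X n))\<^sup>2 + (norm (matrix_power Y n))\<^sup>2)"
proof -
  define w where "w a e = matrix_power X a ** D ** matrix_power Y e" for a e
  \<comment> \<open>The inner product depends only on the total exponents, so one pair of totals can
    be split in several ways and each split estimated separately.\<close>
  have w_inner: "w a e \<bullet> w b f = D \<bullet> w (a + b) (e + f)" for a b e f
  proof -
    have "w a e \<bullet> w b f = D \<bullet> (matrix_power X a ** w b f ** matrix_power Y e)"
      unfolding w_def[of a e] inner_matrix_mul_right[of _ "matrix_power Y e"]
        inner_matrix_mul_left[of "matrix_power X a"]
      by (simp add: transpose_matrix_power sym matrix_mul_assoc)
    also have "matrix_power X a ** w b f ** matrix_power Y e = w (a + b) (f + e)"
      by (simp add: w_def matrix_power_add matrix_mul_assoc)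
    finally show ?thesis by (simp add: add.commute)
  qed
  have am_gm: "2 * (x \<bullet> y) \<le> (norm x)\<^sup>2 + (norm y)\<^sup>2" for x y :: "real^'n^'n"
    using inner_ge_zero[of "x - y"] by (simp add: power2_norm_eq_inner algebra_simps inner_commute)
  define g where "g a = (norm (w a (n - a)))\<^sup>2" for a
  have g_eq: "g a = D \<bullet> w (2 * a) (2 * n - 2 * a)" if "a \<le> n" for a
    using that by (simp add: g_def power2_norm_eq_inner w_inner mult_2 add_diff_add)
  have g_convex: "2 * g a \<le> g (a - 1) + g (a + 1)" if "0 < a" "a < n" for a
  proof -
    have "2 * a = (a - 1) + (a + 1)" "2 * n - 2 * a = (n - (a - 1)) + (n - (a + 1))"
      using that by auto
    then have "g a = w (a - 1) (n - (a - 1)) \<bullet> w (a + 1) (n - (a + 1))"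
      using g_eq[of a] that by (simp only: w_inner)
    then show ?thesis unfolding g_def using am_gm by simp
  qed
  have g0: "g 0 \<le> R\<^sup>2 * (norm (matrix_power Y n))\<^sup>2"
    using norm_matrix_mul_le[OF bound] by (simp add: g_def w_def)
  have gn: "g n \<le> R\<^sup>2 * (norm (matrix_power X n))\<^sup>2"
    using norm_matrix_mul_symmetric_le[OF bound] sym by (simp add: g_def w_def)
  have g_nonneg: "g a \<ge> 0" for a by (simp add: g_def)
  have g_le: "g a \<le> R\<^sup>2 * ((norm (matrix_power X n))\<^sup>2 + (norm (matrix_power Y n))\<^sup>2)" if "a \<le> n" for a
    using convex_seq_le_endpoints[OF g_convex that] g0 gn g_nonneg[of 0] g_nonneg[of n]
    by (simp add: distrib_left)
  show ?thesis
  \<comment> \<open>An even \<open>q\<close> is itself a value of \<open>g\<close>; an odd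
    \<open>q\<close> splits into two adjacent exponents and is at most the mean of two neighbouring
    values of \<open>g\<close>.\<close>
  proof (cases "even q")
    case True
    then obtain a where "q = 2 * a" by blast
    then show ?thesis using g_le[of a] g_eq[of a] \<open>q \<le> 2 * n\<close> by (simp add: w_def)
  next
    case False
    then obtain a where a: "q = 2 * a + 1" by (auto elim: oddE)
    then have "a < n" using \<open>q \<le> 2 * n\<close> by simp
    have "q = a + (a + 1)" "2 * n - q = (n - a) + (n - (a + 1))"
      using a \<open>a < n\<close> by auto
    then have "D \<bullet> w q (2 * n - q) = w a (n - a) \<bullet> w (a + 1) (n - (a + 1))"
      by (simp only: w_inner)
    with am_gm[of "w a (n - a)" "w (a + 1) (n - (a + 1))"] have "2 * (D \<bullet> w q (2 * n - q)) \<le> g a + g (a + 1)"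
      by (simp add: g_def)
    with g_le[of a] g_le[of "a + 1"] \<open>a < n\<close> show ?thesis by (simp add: w_def)
  qed
qed

text \<open>Telescoping produces 2n+1 sandwiched terms with one common bound. Their number becomes
  the factor 2n+1 of the moment recursion.\<close>

lemma inner_matrix_power_diff_le:
  fixes X Y :: "real^'n^'n"
  assumes sym: "transpose X = X" "transpose Y = Y"
    and bound: "\<And>v. norm ((X - Y) *v v) \<le> R * norm v"
  shows "(X - Y) \<bullet> (matrix_power X (2 * n + 1) - matrix_power Y (2 * n + 1)) \<le>
    (2 * real n + 1) * R\<^sup>2 * ((norm (matrix_power X n))\<^sup>2 + (norm (matrix_power Y n))\<^sup>2)"
proof -
  have sym': "transpose (X - Y) = X - Y"
    using sym by (simp add: vec_eq_iff transpose_def)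
  have "(X - Y) \<bullet> (matrix_power X (2 * n + 1) - matrix_power Y (2 * n + 1)) =
      (\<Sum>q<2 * n + 1. (X - Y) \<bullet> (matrix_power X q ** (X - Y) ** matrix_power Y (2 * n - q)))"
    unfolding matrix_power_diff inner_sum_right by simp
  also have "\<dots> \<le> (\<Sum>q<2 * n + 1. R\<^sup>2 * ((norm (matrix_power X n))\<^sup>2 + (norm (matrix_power Y n))\<^sup>2))"
    by (intro sum_mono inner_sandwich_le sym sym' bound) auto
  finally show ?thesis by (simp add: algebra_simps)
qed


subsection \<open>Moments of the deviation of a sample drawn without replacement\<close>

abbreviation subsets_of_card :: "nat \<Rightarrow> nat \<Rightarrow> nat set set" where
  "subsets_of_card N b \<equiv> {S. S \<subseteq> {0..<N} \<and> card S = b}"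

text \<open>For \<open>S\<close> uniform among subsets of {0..<N} of fixed size, each index is
  included with probability |S|/N, so this is the sum over \<open>S\<close> minus its expectation.
  Without division by |S|, exchanging \<open>i\<close> for \<open>j\<close> changes it by exactly
  \<open>a i - a j\<close>.\<close>

definition sample_deviation :: "(nat \<Rightarrow> 'a::real_vector) \<Rightarrow> nat \<Rightarrow> nat set \<Rightarrow> 'a" where
  "sample_deviation a N S = (\<Sum>i\<in>S. a i) - (real (card S) / real N) *\<^sub>R (\<Sum>i<N. a i)"

lemma finite_subsets_of_card: "finite (subsets_of_card N b)"
  by (rule finite_subset[of _ "Pow {0..<N}"]) auto

lemma subsets_of_cardD:
  assumes "S \<in> subsets_of_card N b"
  shows "S \<subseteq> {0..<N}" "card S = b" "finite S" "card ({0..<N} - S) = N - b" "b \<le> N"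
proof -
  show S: "S \<subseteq> {0..<N}" "card S = b" using assms by auto
  show fin: "finite S" using S(1) by (rule finite_subset) simp
  show "card ({0..<N} - S) = N - b" using S fin by (simp add: card_Diff_subset)
  show "b \<le> N" using card_mono[OF _ S(1)] S(2) by simp
qed

text \<open>Exchangeability as a reindexing: replacing \<open>i\<close> by \<open>j\<close> in
  \<open>S\<close> and swapping their roles is an involution on the triples with \<open>i\<close>
  inside and \<open>j\<close> outside \<open>S\<close>.\<close>

lemma sum_exchange:
  fixes h :: "nat set \<Rightarrow> nat \<Rightarrow> nat \<Rightarrow> real"
  shows "(\<Sum>S\<in>subsets_of_card N b. \<Sum>i\<in>S. \<Sum>j\<in>{0..<N} - S. h S i j) =
    (\<Sum>S\<in>subsets_of_card N b. \<Sum>i\<in>S. \<Sum>j\<in>{0..<N} - S. h (insert j (S - {i})) j i)"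
proof -
  have fin: "finite S" if "S \<in> subsets_of_card N b" for S
    using that by (rule subsets_of_cardD)
  have flat: "(\<Sum>S\<in>subsets_of_card N b. \<Sum>i\<in>S. \<Sum>j\<in>{0..<N} - S. k S i j) =
      (\<Sum>(S, i, j)\<in>Sigma (subsets_of_card N b) (\<lambda>S. S \<times> ({0..<N} - S)). k S i j)"
    for k :: "nat set \<Rightarrow> nat \<Rightarrow> nat \<Rightarrow> real"
  proof -
    have "(\<Sum>S\<in>subsets_of_card N b. \<Sum>i\<in>S. \<Sum>j\<in>{0..<N} - S. k S i j) =
      (\<Sum>S\<in>subsets_of_card N b. \<Sum>(i, j)\<in>S \<times> ({0..<N} - S). k S i j)"
      by (intro sum.cong refl sum.cartesian_product)
    also have "\<dots> = (\<Sum>(S, i, j)\<in>Sigma (subsets_of_card N b) (\<lambda>S. S \<times> ({0..<N} - S)). k S i j)"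
      by (rule sum.Sigma[OF finite_subsets_of_card]) (simp add: finite_subset[of _ "{0..<N}"])
    finally show ?thesis .
  qed
  have card: "card (insert j (S - {i})) = card S" if "i \<in> S" "j \<notin> S" "finite S" for i j and S :: "nat set"
    using that by (metis Diff_iff card_insert_disjoint card_Suc_Diff1 finite_Diff)
  let ?swap = "\<lambda>(S, i, j). (insert j (S - {i}), j, i)"
  have swap_in: "?swap t \<in> Sigma (subsets_of_card N b) (\<lambda>S. S \<times> ({0..<N} - S))"
    if "t \<in> Sigma (subsets_of_card N b) (\<lambda>S. S \<times> ({0..<N} - S))" for t
  proof -
    obtain S i j where t: "t = (S, i, j)" by (cases t)
    with that have S: "S \<in> subsets_of_card N b" and ij: "i \<in> S" "j \<in> {0..<N} - S" by auto
    then show ?thesis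
      using card[OF ij(1) _ fin[OF S], of j] by (auto simp: t)
  qed
  have swap_swap: "?swap (?swap t) = t"
    if "t \<in> Sigma (subsets_of_card N b) (\<lambda>S. S \<times> ({0..<N} - S))" for t
    using that by (auto split: prod.splits)
  show ?thesis
    unfolding flat
    by (rule sum.reindex_bij_witness[where i = ?swap and j = ?swap])
      (simp_all only: swap_in swap_swap, auto simp: insert_absorb)
qed

text \<open>The sum inside \<open>S\<close> is counted N - |S| times and the sum outside, which is
  the total minus the inside, |S| times.\<close>

lemma sum_differences_eq_sample_deviation:
  fixes a :: "nat \<Rightarrow> 'a::real_vector"
  assumes "S \<subseteq> {0..<N}" "N > 0"
  shows "(\<Sum>i\<in>S. \<Sum>j\<in>{0..<N} - S. a i - a j) = real N *\<^sub>R sample_deviation a N S"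
proof -
  have fin: "finite S" using assms(1) by (rule finite_subset) simp
  have compl: "(\<Sum>j\<in>{0..<N} - S. a j) = (\<Sum>i<N. a i) - (\<Sum>i\<in>S. a i)"
    using assms(1) by (simp add: sum_diff lessThan_atLeast0)
  have card: "real (card ({0..<N} - S)) = real N - real (card S)"
    using assms(1) fin card_mono[OF _ assms(1)] by (simp add: card_Diff_subset)
  have "(\<Sum>i\<in>S. \<Sum>j\<in>{0..<N} - S. a i - a j) =
      real (card ({0..<N} - S)) *\<^sub>R (\<Sum>i\<in>S. a i) - real (card S) *\<^sub>R (\<Sum>j\<in>{0..<N} - S. a j)"
    by (simp add: sum_subtractf scaleR_sum_right sum_constant_scaleR)
  also have "\<dots> = real N *\<^sub>R sample_deviation a N S"
    unfolding compl card sample_deviation_def using \<open>N > 0\<close> by (simp add: algebra_simps)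
  finally show ?thesis .
qed

lemma sample_deviation_exchange:
  fixes a :: "nat \<Rightarrow> 'a::real_vector"
  assumes "finite S" "i \<in> S" "j \<notin> S"
  shows "sample_deviation a N S - sample_deviation a N (insert j (S - {i})) = a i - a j"
proof -
  have "card (insert j (S - {i})) = card S"
    using assms by (metis Diff_iff card_insert_disjoint card_Suc_Diff1 finite_Diff)
  then show ?thesis
    using assms by (simp add: sample_deviation_def sum_diff1)
qed

lemma transpose_sample_deviation:
  fixes a :: "nat \<Rightarrow> real^'n^'n"
  assumes "\<And>i. i < N \<Longrightarrow> transpose (a i) = a i" "S \<subseteq> {0..<N}"
  shows "transpose (sample_deviation a N S) = sample_deviation a N S"
proof -
  have "a i $ p $ q = a i $ q $ p" if "i < N" for i p q
    using assms(1)[OF that] by (metis transpose_def vec_lambda_beta)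
  moreover have "i < N" if "i \<in> S" for i
    using that assms(2) by auto
  ultimately show ?thesis
    by (simp add: sample_deviation_def vec_eq_iff transpose_def)
qed

lemma sample_moment_Suc_le:
  fixes a :: "nat \<Rightarrow> real^'n^'n"
  assumes sym: "\<And>i. i < N \<Longrightarrow> transpose (a i) = a i"
    and bound: "\<And>i j v. i < N \<Longrightarrow> j < N \<Longrightarrow> norm ((a i - a j) *v v) \<le> R * norm v"
    and "b \<le> N" "N > 0"
  shows "real N * (\<Sum>S\<in>subsets_of_card N b. (norm (matrix_power (sample_deviation a N S) (Suc n)))\<^sup>2) \<le>
    (2 * real n + 1) * (R\<^sup>2 * real b * real (N - b)) *
      (\<Sum>S\<in>subsets_of_card N b. (norm (matrix_power (sample_deviation a N S) n))\<^sup>2)"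
proof -
  define X where "X = sample_deviation a N"
  define P where "P S = matrix_power (X S) (2 * n + 1)" for S
  define m where "m S = (norm (matrix_power (X S) n))\<^sup>2" for S
  define tot where "tot h = (\<Sum>S\<in>subsets_of_card N b. \<Sum>i\<in>S. \<Sum>j\<in>{0..<N} - S. h S i j)"
    for h :: "nat set \<Rightarrow> nat \<Rightarrow> nat \<Rightarrow> real"
  have X_sym: "transpose (X S) = X S" if "S \<subseteq> {0..<N}" for S
    unfolding X_def by (rule transpose_sample_deviation[OF sym that])
  \<comment> \<open>One factor \<open>X S\<close> is split off from the power 2n+2 and expanded into
    the differences \<open>a i - a j\<close>.\<close>
  have lhs: "real N * (\<Sum>S\<in>subsets_of_card N b. (norm (matrix_power (X S) (Suc n)))\<^sup>2) =
      tot (\<lambda>S i j. (a i - a j) \<bullet> P S)"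
    unfolding tot_def sum_distrib_left
  proof (rule sum.cong[OF refl])
    fix S assume "S \<in> subsets_of_card N b"
    note S = subsets_of_cardD(1)[OF this]
    have "(norm (matrix_power (X S) (Suc n)))\<^sup>2 = (X S ** matrix_power (X S) n) \<bullet> matrix_power (X S) (Suc n)"
      by (simp add: power2_norm_eq_inner)
    also have "\<dots> = X S \<bullet> (matrix_power (X S) (Suc n) ** matrix_power (X S) n)"
      by (simp add: inner_matrix_mul_right transpose_matrix_power X_sym[OF S])
    also have "\<dots> = X S \<bullet> P S"
      by (simp add: P_def mult_2 flip: matrix_power_add matrix_power.simps(2))
    finally have "real N * (norm (matrix_power (X S) (Suc n)))\<^sup>2 =
        (\<Sum>i\<in>S. \<Sum>j\<in>{0..<N} - S. a i - a j) \<bullet> P S"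
      using sum_differences_eq_sample_deviation[OF S \<open>N > 0\<close>, of a] by (simp add: X_def)
    then show "real N * (norm (matrix_power (X S) (Suc n)))\<^sup>2 =
        (\<Sum>i\<in>S. \<Sum>j\<in>{0..<N} - S. (a i - a j) \<bullet> P S)"
      by (simp add: inner_sum_left)
  qed
  have step: "(a i - a j) \<bullet> P S + (a j - a i) \<bullet> P (insert j (S - {i})) \<le>
      (2 * real n + 1) * R\<^sup>2 * (m S + m (insert j (S - {i})))"
    if "S \<in> subsets_of_card N b" "i \<in> S" "j \<in> {0..<N} - S" for S i j
  proof -
    let ?S' = "insert j (S - {i})"
    note S = subsets_of_cardD[OF that(1)]
    have S': "?S' \<subseteq> {0..<N}" using S(1) that by auto
    have diff: "X S - X ?S' = a i - a j"
      unfolding X_def using S that by (intro sample_deviation_exchange) auto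
    have "norm ((X S - X ?S') *v v) \<le> R * norm v" for v
      unfolding diff using S(1) that by (intro bound) auto
    from inner_matrix_power_diff_le[OF X_sym[OF S(1)] X_sym[OF S'] this, of n]
    show ?thesis
      unfolding diff by (simp add: P_def m_def inner_diff_left inner_diff_right)
  qed
  \<comment> \<open>Each \<open>S\<close> admits b (N - b) exchange pairs; this count is the source
    of the finite-population factor in the variance.\<close>
  have const: "tot (\<lambda>S i j. c * m S) = c * (real b * real (N - b)) * (\<Sum>S\<in>subsets_of_card N b. m S)" for c
    unfolding tot_def sum_distrib_left
  proof (rule sum.cong[OF refl])
    fix S assume "S \<in> subsets_of_card N b"
    note S = subsets_of_cardD[OF this]
    show "(\<Sum>i\<in>S. \<Sum>j\<in>{0..<N} - S. c * m S) = c * (real b * real (N - b)) * m S"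
      by (simp only: sum_constant S(2,4)) simp
  qed
  have add: "tot h + tot k = tot (\<lambda>S i j. h S i j + k S i j)" for h k
    by (simp add: tot_def sum.distrib)
  let ?c = "(2 * real n + 1) * R\<^sup>2"
  \<comment> \<open>Averaging with the exchanged copy turns \<open>P S\<close> into a difference of
    powers at \<open>S\<close> and its exchange, where the mean value inequality applies. A second
    exchange merges the two moments on the right.\<close>
  have "2 * tot (\<lambda>S i j. (a i - a j) \<bullet> P S) =
      tot (\<lambda>S i j. (a i - a j) \<bullet> P S) + tot (\<lambda>S i j. (a j - a i) \<bullet> P (insert j (S - {i})))"
    using sum_exchange[where h = "\<lambda>S i j. (a i - a j) \<bullet> P S" and N = N and b = b] by (simp add: tot_def)
  also have "\<dots> \<le> tot (\<lambda>S i j. ?c * (m S + m (insert j (S - {i}))))"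
    unfolding add unfolding tot_def by (intro sum_mono step)
  also have "\<dots> = tot (\<lambda>S i j. ?c * m S) + tot (\<lambda>S i j. ?c * m (insert j (S - {i})))"
    unfolding add by (simp add: distrib_left)
  also have "\<dots> = 2 * tot (\<lambda>S i j. ?c * m S)"
    using sum_exchange[where h = "\<lambda>S i j. ?c * m S" and N = N and b = b] by (simp add: tot_def)
  finally have "tot (\<lambda>S i j. (a i - a j) \<bullet> P S) \<le> tot (\<lambda>S i j. ?c * m S)" by simp
  then show ?thesis
    unfolding const lhs[unfolded X_def, symmetric] by (simp add: m_def X_def mult.assoc)
qed

section \<open>Gaussian moment growth and the tail bound\<close>

lemma norm_mat_1: "(norm (mat 1 :: real^'n^'n))\<^sup>2 = real CARD('n)"
proof -
  have "(norm (mat 1 :: real^'n^'n))\<^sup>2 = (\<Sum>i\<in>UNIV. \<Sum>j\<in>UNIV. if i = (j :: 'n) then 1 else 0)"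
    unfolding power2_norm_eq_inner inner_vec_def by (intro sum.cong refl) (simp add: mat_def)
  then show ?thesis by simp
qed

text \<open>The coefficient (2n)!/(2^n n!) is the double factorial (2n-1)!!, so the growth is that
  of Gaussian moments with variance \<open>V\<close>. The dimension enters through the zeroth
  moment, the squared norm of the identity.\<close>

lemma sample_moment_le:
  fixes a :: "nat \<Rightarrow> real^'n^'n"
  assumes sym: "\<And>i. i < N \<Longrightarrow> transpose (a i) = a i"
    and bound: "\<And>i j v. i < N \<Longrightarrow> j < N \<Longrightarrow> norm ((a i - a j) *v v) \<le> R * norm v"
    and "b \<le> N" "N > 0"
  defines "V \<equiv> R\<^sup>2 * real b * real (N - b) / real N"
  shows "(\<Sum>S\<in>subsets_of_card N b. (norm (matrix_power (sample_deviation a N S) n))\<^sup>2) \<le>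
    fact (2 * n) / (2 ^ n * fact n) * V ^ n * (real CARD('n) * real (card (subsets_of_card N b)))"
proof (induction n)
  case 0
  show ?case by (simp add: norm_mat_1)
next
  case (Suc n)
  define T where "T n = (\<Sum>S\<in>subsets_of_card N b. (norm (matrix_power (sample_deviation a N S) n))\<^sup>2)" for n
  define K where "K = real CARD('n) * real (card (subsets_of_card N b))"
  have "V \<ge> 0" by (simp add: V_def)
  have "T (Suc n) \<le> (2 * real n + 1) * V * T n"
    using sample_moment_Suc_le[where a = a and n = n, OF sym bound \<open>b \<le> N\<close> \<open>N > 0\<close>] \<open>N > 0\<close>
    unfolding T_def[symmetric] V_def by (simp add: field_simps)
  also have "\<dots> \<le> (2 * real n + 1) * V * (fact (2 * n) / (2 ^ n * fact n) * V ^ n * K)"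
    using Suc.IH \<open>V \<ge> 0\<close> by (intro mult_left_mono) (simp_all add: T_def K_def)
  also have "\<dots> = ((2 * real n + 1) * (fact (2 * n) / (2 ^ n * fact n))) * V ^ Suc n * K"
    by simp
  also have "(2 * real n + 1) * (fact (2 * n) / (2 ^ n * fact n)) =
      fact (2 * Suc n) / (2 ^ Suc n * fact (Suc n))"
    by (simp add: divide_simps)
  finally show ?case by (simp only: T_def K_def)
qed

lemma cosh_sums_even: "(\<lambda>n. x ^ (2 * n) / fact (2 * n)) sums cosh (x :: real)"
proof -
  have "(\<lambda>n. if even n then x ^ n /\<^sub>R fact n else 0) sums cosh x"
    by (rule cosh_converges)
  then have "(\<lambda>n. if even (2 * n) then x ^ (2 * n) /\<^sub>R fact (2 * n) else 0) sums cosh x"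
    by (subst sums_mono_reindex[where g = "\<lambda>n. 2 * n" and f = "\<lambda>n. if even n then x ^ n /\<^sub>R fact n else 0"])
      (auto simp: strict_mono_def elim!: evenE)
  then show ?thesis by (simp add: divide_inverse mult.commute)
qed

text \<open>Weighting the \<^term>\<open>2 * n\<close>-th moments by \<^term>\<open>(t / V) ^ (2 * n) / fact (2 * n)\<close> and
  summing turns Markov's inequality into a Chernoff bound for the hyperbolic cosine.\<close>

lemma sample_tail_symmetric:
  fixes a :: "nat \<Rightarrow> real^'n^'n"
  assumes sym: "\<And>i. i < N \<Longrightarrow> transpose (a i) = a i"
    and bound: "\<And>i j v. i < N \<Longrightarrow> j < N \<Longrightarrow> norm ((a i - a j) *v v) \<le> R * norm v"
    and "0 < b" "b < N" "R > 0" "t \<ge> 0"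
    and B: "B \<subseteq> subsets_of_card N b"
      "\<And>S. S \<in> B \<Longrightarrow> \<exists>u. norm u = 1 \<and> t \<le> norm (sample_deviation a N S *v u)"
  defines "V \<equiv> R\<^sup>2 * real b * real (N - b) / real N"
  shows "real (card B) \<le> 2 * real CARD('n) * exp (- (t\<^sup>2 / (2 * V))) * real (card (subsets_of_card N b))"
proof -
  define K where "K = real CARD('n) * real (card (subsets_of_card N b))"
  have "V > 0" using assms(3-5) by (simp add: V_def)
  \<comment> \<open>Markov's inequality by counting: every \<open>S\<close> in \<open>B\<close>
    contributes at least t^(2n) to the moment sum.\<close>
  have moment: "real (card B) * t ^ (2 * n) \<le> fact (2 * n) / (2 ^ n * fact n) * V ^ n * K" for n
  proof -
    let ?m = "\<lambda>S. (norm (matrix_power (sample_deviation a N S) n))\<^sup>2"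
    have "t ^ (2 * n) \<le> ?m S" if S_in: "S \<in> B" for S
    proof -
      obtain u where u: "norm u = 1" "t \<le> norm (sample_deviation a N S *v u)"
        using B(2)[OF S_in] by blast
      have S: "transpose (sample_deviation a N S) = sample_deviation a N S"
        using B(1) S_in by (intro transpose_sample_deviation sym) auto
      have "t ^ n \<le> norm (sample_deviation a N S *v u) ^ n"
        using u(2) \<open>t \<ge> 0\<close> by (rule power_mono)
      also have "\<dots> \<le> norm (matrix_power (sample_deviation a N S) n)"
        by (rule norm_power_le_norm_matrix_power[OF S u(1)])
      finally show ?thesis
        using \<open>t \<ge> 0\<close> by (simp add: power_mono power_mult mult.commute[of 2 n])
    qed
    then have "real (card B) * t ^ (2 * n) \<le> (\<Sum>S\<in>B. ?m S)"
      using sum_mono[of B "\<lambda>_. t ^ (2 * n)" ?m] by simp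
    also have "\<dots> \<le> (\<Sum>S\<in>subsets_of_card N b. ?m S)"
      by (rule sum_mono2[OF finite_subsets_of_card B(1)]) simp
    also have "\<dots> \<le> fact (2 * n) / (2 ^ n * fact n) * V ^ n * K"
      using sample_moment_le[where a = a and N = N and b = b and n = n, OF sym bound] \<open>b < N\<close> unfolding V_def K_def by simp
    finally show ?thesis .
  qed
  \<comment> \<open>This value minimises the Chernoff exponent \<theta>^2 V / 2 - \<theta>
    t.\<close>
  define \<theta> where "\<theta> = t / V"
  have term_le: "real (card B) * ((\<theta> * t) ^ (2 * n) / fact (2 * n)) \<le> K * ((\<theta>\<^sup>2 * V / 2) ^ n /\<^sub>R fact n)" for n
  proof -
    have "\<theta> ^ (2 * n) / fact (2 * n) * (real (card B) * t ^ (2 * n)) \<le>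
        \<theta> ^ (2 * n) / fact (2 * n) * (fact (2 * n) / (2 ^ n * fact n) * V ^ n * K)"
      by (intro mult_left_mono moment) (simp add: power_mult)
    then show ?thesis
      by (simp add: power_mult_distrib power_divide field_simps flip: power_mult)
  qed
  have "(\<lambda>n. real (card B) * ((\<theta> * t) ^ (2 * n) / fact (2 * n))) sums (real (card B) * cosh (\<theta> * t))"
    by (intro sums_mult cosh_sums_even)
  moreover have "(\<lambda>n. K * ((\<theta>\<^sup>2 * V / 2) ^ n /\<^sub>R fact n)) sums (K * exp (\<theta>\<^sup>2 * V / 2))"
    by (intro sums_mult exp_converges)
  ultimately have "real (card B) * cosh (\<theta> * t) \<le> K * exp (\<theta>\<^sup>2 * V / 2)"
    by (rule sums_le[OF term_le])
  \<comment> \<open>Discarding the decaying exponential costs the factor 2 in front of the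
    dimension.\<close>
  moreover have "exp (\<theta> * t) / 2 \<le> cosh (\<theta> * t)"
    by (simp add: cosh_def)
  ultimately have "real (card B) * (exp (\<theta> * t) / 2) \<le> K * exp (\<theta>\<^sup>2 * V / 2)"
    by (meson mult_left_mono of_nat_0_le_iff order_trans)
  then have "real (card B) \<le> 2 * K * (exp (\<theta>\<^sup>2 * V / 2) / exp (\<theta> * t))"
    by (simp add: field_simps)
  also have "exp (\<theta>\<^sup>2 * V / 2) / exp (\<theta> * t) = exp (- (t\<^sup>2 / (2 * V)))"
    using \<open>V > 0\<close> by (simp add: \<theta>_def power2_eq_square field_simps flip: exp_diff)
  finally show ?thesis by (simp add: K_def mult_ac)
qed

subsection \<open>Hermitian dilation of rectangular matrices\<close>

text \<open>The block matrix with zero diagonal blocks, \<open>A\<close> at the upper right and its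
  transpose at the lower left. The sum type as index makes the dimension m + n.\<close>

definition dilation :: "real^'n^'m \<Rightarrow> real^('m + 'n)^('m + 'n)" where
  "dilation A = (\<chi> i j. case (i, j) of (Inl p, Inr q) \<Rightarrow> A $ p $ q
    | (Inr q, Inl p) \<Rightarrow> A $ p $ q | _ \<Rightarrow> 0)"

lemma linear_dilation: "linear dilation"
  by (rule linearI) (auto simp: dilation_def vec_eq_iff split: sum.splits)

lemma transpose_dilation: "transpose (dilation A) = dilation A"
  by (auto simp: dilation_def vec_eq_iff transpose_def split: sum.splits)

lemma sum_UNIV_Plus:
  fixes h :: "'m::finite + 'n::finite \<Rightarrow> 'a::comm_monoid_add"
  shows "(\<Sum>i\<in>UNIV. h i) = (\<Sum>p\<in>UNIV. h (Inl p)) + (\<Sum>q\<in>UNIV. h (Inr q))"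
  by (subst UNIV_Plus_UNIV[symmetric], subst sum.Plus) simp_all

lemma norm_vec_Plus:
  fixes z :: "real^('m::finite + 'n::finite)"
  shows "(norm z)\<^sup>2 = (norm (\<chi> p. z $ Inl p))\<^sup>2 + (norm (\<chi> q. z $ Inr q))\<^sup>2"
  by (simp add: power2_norm_eq_inner inner_vec_def sum_UNIV_Plus)

lemma dilation_mult_Inl: "(\<chi> p. (dilation A *v z) $ Inl p) = A *v (\<chi> q. z $ Inr q)"
  by (simp add: vec_eq_iff matrix_vector_mult_def dilation_def sum_UNIV_Plus)

lemma dilation_mult_Inr: "(\<chi> q. (dilation A *v z) $ Inr q) = transpose A *v (\<chi> p. z $ Inl p)"
  by (simp add: vec_eq_iff matrix_vector_mult_def transpose_def dilation_def sum_UNIV_Plus)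

text \<open>Pairing A^T v with itself moves one transpose across: |A^T v|^2 = v . A (A^T v), to
  which Cauchy-Schwarz and the bound on \<open>A\<close> apply.\<close>

lemma norm_transpose_mult_le:
  fixes A :: "real^'n^'m"
  assumes "\<And>v. norm (A *v v) \<le> R * norm v" "R \<ge> 0"
  shows "norm (transpose A *v v) \<le> R * norm v"
proof -
  let ?w = "transpose A *v v"
  have "(norm ?w)\<^sup>2 = v \<bullet> (A *v ?w)"
    using dot_lmul_matrix[of v A ?w] by (simp add: power2_norm_eq_inner)
  also have "\<dots> \<le> norm v * norm (A *v ?w)" by (rule norm_cauchy_schwarz)
  also have "\<dots> \<le> norm v * (R * norm ?w)" by (intro mult_left_mono assms) simp
  finally have "norm ?w * norm ?w \<le> R * norm v * norm ?w" by (simp add: power2_eq_square mult_ac)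
  then show ?thesis using assms(2) by (cases "norm ?w = 0") auto
qed

lemma norm_dilation_mult_le:
  fixes A :: "real^'n^'m"
  assumes "\<And>v. norm (A *v v) \<le> R * norm v" "R \<ge> 0"
  shows "norm (dilation A *v z) \<le> R * norm z"
proof (rule power2_le_imp_le)
  have "(norm (dilation A *v z))\<^sup>2 =
      (norm (A *v (\<chi> q. z $ Inr q)))\<^sup>2 + (norm (transpose A *v (\<chi> p. z $ Inl p)))\<^sup>2"
    by (simp add: norm_vec_Plus[of "dilation A *v z"] dilation_mult_Inl dilation_mult_Inr)
  also have "\<dots> \<le> (R * norm (\<chi> q. z $ Inr q))\<^sup>2 + (R * norm (\<chi> p. z $ Inl p))\<^sup>2"
    by (intro add_mono power_mono assms norm_transpose_mult_le) auto
  also have "\<dots> = (R * norm z)\<^sup>2"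
    by (simp add: norm_vec_Plus[of z] power_mult_distrib distrib_left)
  finally show "(norm (dilation A *v z))\<^sup>2 \<le> (R * norm z)\<^sup>2" .
qed (use assms in simp)

lemma norm_mult_le_dilation:
  fixes A :: "real^'n^'m"
  obtains z where "norm z = norm v" "norm (dilation A *v z) = norm (A *v v)"
proof
  \<comment> \<open>On the block vector (0, v) the dilation acts as \<open>A\<close> alone.\<close>
  define z :: "real^('m + 'n)" where "z = (\<chi> i. case i of Inl p \<Rightarrow> 0 | Inr q \<Rightarrow> v $ q)"
  have z: "(\<chi> p. z $ Inl p) = 0" "(\<chi> q. z $ Inr q) = v"
    by (simp_all add: z_def vec_eq_iff)
  have "(norm z)\<^sup>2 = (norm v)\<^sup>2" by (simp add: norm_vec_Plus[of z] z)
  then show "norm z = norm v" by simp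
  have "(norm (dilation A *v z))\<^sup>2 = (norm (A *v v))\<^sup>2"
    by (simp add: norm_vec_Plus[of "dilation A *v z"] dilation_mult_Inl dilation_mult_Inr z)
  then show "norm (dilation A *v z) = norm (A *v v)" by simp
qed

lemma linear_sample_deviation:
  fixes L :: "'a::real_vector \<Rightarrow> 'b::real_vector"
  assumes "linear L"
  shows "L (sample_deviation a N S) = sample_deviation (\<lambda>i. L (a i)) N S"
  by (simp add: sample_deviation_def linear_diff[OF assms] linear_scale[OF assms]
      linear_sum[OF assms])

text \<open>Differences of matrices bounded by \<sigma> are bounded by R = 2 \<sigma>, so the
  denominator 2 V of the symmetric bound becomes 8 \<sigma>^2 b (N - b) / N.\<close>

lemma sample_tail:
  fixes a :: "nat \<Rightarrow> real^'n^'m"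
  assumes bound: "\<And>i v. i < N \<Longrightarrow> norm (a i *v v) \<le> \<sigma> * norm v"
    and "0 < b" "b < N" "\<sigma> > 0" "t > 0"
    and B: "B \<subseteq> subsets_of_card N b"
      "\<And>S. S \<in> B \<Longrightarrow> t < onorm ((*v) (sample_deviation a N S))"
  shows "real (card B) \<le> 2 * (real CARD('m) + real CARD('n)) *
      exp (- (t\<^sup>2 / (8 * \<sigma>\<^sup>2 * real b * real (N - b) / real N))) * real (card (subsets_of_card N b))"
proof -
  have diff: "norm ((dilation (a i) - dilation (a j)) *v v) \<le> 2 * \<sigma> * norm v"
    if "i < N" "j < N" for i j v
  proof -
    have "norm ((a i - a j) *v w) \<le> 2 * \<sigma> * norm w" for w
      using norm_triangle_ineq4[of "a i *v w" "a j *v w"] bound[OF that(1), of w] bound[OF that(2), of w]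
      by (simp add: matrix_vector_mult_diff_rdistrib)
    then show ?thesis
      unfolding linear_diff[OF linear_dilation, symmetric]
      using \<open>\<sigma> > 0\<close> by (intro norm_dilation_mult_le) auto
  qed
  have witness: "\<exists>u. norm u = 1 \<and> t \<le> norm (sample_deviation (\<lambda>i. dilation (a i)) N S *v u)"
    if S_in: "S \<in> B" for S
  proof -
    let ?X = "sample_deviation a N S"
    \<comment> \<open>An operator norm above \<open>t\<close> is witnessed by a vector; normalised
      and lifted to the dilation, it becomes the unit vector required.\<close>
    obtain w where w: "t * norm w < norm (?X *v w)"
      using B(2)[OF S_in] onorm_le[of "(*v) ?X" t] by (meson not_less)
    then have "w \<noteq> 0" by auto
    obtain z where z: "norm z = norm (w /\<^sub>R norm w)" "norm (dilation ?X *v z) = norm (?X *v (w /\<^sub>R norm w))"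
      by (rule norm_mult_le_dilation)
    have "norm (?X *v (w /\<^sub>R norm w)) = norm (?X *v w) / norm w"
      by (simp add: matrix_vector_mult_scaleR divide_inverse mult.commute)
    moreover have "t \<le> norm (?X *v w) / norm w"
      using w \<open>w \<noteq> 0\<close> by (simp add: pos_le_divide_eq)
    ultimately have "norm z = 1" "t \<le> norm (dilation ?X *v z)"
      using z \<open>w \<noteq> 0\<close> by simp_all
    then show ?thesis by (auto simp: linear_sample_deviation[OF linear_dilation])
  qed
  have "real CARD('m + 'n) = real CARD('m) + real CARD('n)" by simp
  with sample_tail_symmetric[OF transpose_dilation diff \<open>0 < b\<close> \<open>b < N\<close> _ _ B(1) witness] \<open>\<sigma> > 0\<close> \<open>t > 0\<close>
  show ?thesis by (simp add: power_mult_distrib mult.assoc)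
qed

subsection \<open>Concentration of the subsampled estimators\<close>

text \<open>Common core of both claims. The abstract event \<open>Q\<close> lets each caller
  translate the bound on the operator norm into its own norm and estimator.\<close>

lemma subset_sample_concentration:
  fixes a :: "nat \<Rightarrow> real^'n^'m" and \<sigma> \<epsilon> \<zeta> :: real
  assumes bound: "\<And>i v. i < N \<Longrightarrow> norm (a i *v v) \<le> \<sigma> * norm v"
    and "b < N" "\<sigma> \<ge> 0" "\<epsilon> > 0" "0 < \<zeta>" "\<zeta> < 1"
    and size: "real b \<ge> inverse (1 / real N +
      \<epsilon>\<^sup>2 / (64 * \<sigma>\<^sup>2 * ln (2 * (real CARD('m) + real CARD('n)) / \<zeta>)))"
    and event: "\<And>S. S \<subseteq> {0..<N} \<Longrightarrow> card S = b \<Longrightarrow> 0 < b \<Longrightarrow>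
      onorm ((*v) (sample_deviation a N S)) \<le> real b * \<epsilon> \<Longrightarrow> Q S"
  shows "measure_pmf.prob (subset_sample N b) {S. Q S} \<ge> 1 - \<zeta>"
proof -
  define K where "K = 2 * (real CARD('m) + real CARD('n))"
  define l where "l = ln (K / \<zeta>)"
  have "CARD('m) \<ge> 1" "CARD('n) \<ge> 1"
    using zero_less_card_finite by (auto simp: Suc_le_eq)
  then have "real 1 + real 1 \<le> real CARD('m) + real CARD('n)"
    by (intro add_mono of_nat_mono)
  then have "K > 1" by (simp add: K_def)
  then have "l > 0" using \<open>0 < \<zeta>\<close> \<open>\<zeta> < 1\<close> by (simp add: l_def)
  define q where "q = 1 / real N + \<epsilon>\<^sup>2 / (64 * \<sigma>\<^sup>2 * l)"
  have "q > 0" using \<open>l > 0\<close> \<open>b < N\<close> by (simp add: q_def add_pos_nonneg)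
  have b_ge: "real b \<ge> inverse q"
    using size by (simp add: q_def l_def K_def)
  with \<open>q > 0\<close> have "real b > 0" by (meson inverse_positive_iff_positive less_le_trans)
  then have "b > 0" by simp
  have "1 / real b \<le> q"
    using b_ge \<open>q > 0\<close> \<open>real b > 0\<close> by (simp add: field_simps)
  \<comment> \<open>For \<sigma> = 0 the quotient is 0 by the convention on division by zero, so the
    size condition would force b to be at least N.\<close>
  have "\<sigma> \<noteq> 0"
  proof
    assume "\<sigma> = 0"
    with \<open>1 / real b \<le> q\<close> have "1 / real b \<le> 1 / real N" by (simp add: q_def)
    with \<open>b < N\<close> \<open>b > 0\<close> show False by (simp add: field_simps)
  qed
  with \<open>\<sigma> \<ge> 0\<close> have "\<sigma> > 0" by simp
  define V where "V = 8 * \<sigma>\<^sup>2 * real b * real (N - b) / real N"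
  have "V > 0" using \<open>b > 0\<close> \<open>b < N\<close> \<open>\<sigma> > 0\<close> by (simp add: V_def)
  have "1 / real b - 1 / real N \<le> \<epsilon>\<^sup>2 / (64 * \<sigma>\<^sup>2 * l)"
    using \<open>1 / real b \<le> q\<close> by (simp add: q_def)
  then have "(1 / real b - 1 / real N) * (64 * \<sigma>\<^sup>2 * l) \<le> \<epsilon>\<^sup>2"
    using \<open>\<sigma> > 0\<close> \<open>l > 0\<close> by (simp add: pos_le_divide_eq)
  then have "(real b)\<^sup>2 * ((1 / real b - 1 / real N) * (64 * \<sigma>\<^sup>2 * l)) \<le> (real b)\<^sup>2 * \<epsilon>\<^sup>2"
    by (rule mult_left_mono) simp
  \<comment> \<open>Here b^2 (1/b - 1/N) = b (N - b) / N and 64 = 8 * 8; one factor 8 belongs to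
    \<open>V\<close>, the other is slack dropped next.\<close>
  moreover have "(real b)\<^sup>2 * ((1 / real b - 1 / real N) * (64 * \<sigma>\<^sup>2 * l)) = 8 * (l * V)"
    using \<open>b > 0\<close> \<open>b < N\<close> by (simp add: V_def of_nat_diff field_simps power2_eq_square)
  moreover have "l * V > 0" using \<open>l > 0\<close> \<open>V > 0\<close> by simp
  ultimately have "l * V \<le> (real b * \<epsilon>)\<^sup>2"
    by (simp add: power_mult_distrib)
  then have exponent: "l \<le> (real b * \<epsilon>)\<^sup>2 / V"
    using \<open>V > 0\<close> by (simp add: pos_le_divide_eq)
  define \<S> where "\<S> = subsets_of_card N b"
  define B where "B = {S \<in> \<S>. real b * \<epsilon> < onorm ((*v) (sample_deviation a N S))}"
  have fin: "finite \<S>" unfolding \<S>_def by (rule finite_subsets_of_card)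
  have "{0..<b} \<in> \<S>" using \<open>b < N\<close> by (auto simp: \<S>_def)
  then have "\<S> \<noteq> {}" by blast
  then have card_pos: "real (card \<S>) > 0" using fin by (simp add: card_gt_0_iff)
  have "real (card B) \<le> K * exp (- ((real b * \<epsilon>)\<^sup>2 / V)) * real (card \<S>)"
    unfolding K_def V_def \<S>_def
    by (rule sample_tail[OF bound \<open>b > 0\<close> \<open>b < N\<close> \<open>\<sigma> > 0\<close>])
      (use \<open>b > 0\<close> \<open>\<epsilon> > 0\<close> in \<open>auto simp: B_def \<S>_def\<close>)
  also have "\<dots> \<le> K * exp (- l) * real (card \<S>)"
    using exponent \<open>K > 1\<close> by (intro mult_right_mono mult_left_mono) auto
  \<comment> \<open>The logarithm in the sample size was chosen for exactly this
    cancellation.\<close>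
  also have "K * exp (- l) = \<zeta>"
    using \<open>K > 1\<close> \<open>0 < \<zeta>\<close> by (simp add: l_def exp_minus)
  finally have B_le: "real (card B) \<le> \<zeta> * real (card \<S>)" .
  have "\<S> - B \<subseteq> \<S> \<inter> {S. Q S}"
  proof
    fix S assume "S \<in> \<S> - B"
    then have "S \<in> \<S>" "onorm ((*v) (sample_deviation a N S)) \<le> real b * \<epsilon>"
      by (auto simp: B_def)
    with event[of S] \<open>b > 0\<close> show "S \<in> \<S> \<inter> {S. Q S}" by (simp add: \<S>_def)
  qed
  then have "card (\<S> - B) \<le> card (\<S> \<inter> {S. Q S})"
    using fin by (intro card_mono) auto
  moreover have "real (card (\<S> - B)) = real (card \<S>) - real (card B)"
    using fin by (subst card_Diff_subset) (auto simp: B_def intro!: of_nat_diff card_mono)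
  ultimately have "(1 - \<zeta>) * real (card \<S>) \<le> real (card (\<S> \<inter> {S. Q S}))"
    using B_le by (simp add: algebra_simps)
  then show ?thesis
    using card_pos measure_pmf_of_set[OF \<open>\<S> \<noteq> {}\<close> fin]
    by (simp add: subset_sample_def \<S>_def[symmetric] pos_le_divide_eq)
qed

section \<open>From sample deviations to gradient and Hessian estimators\<close>

text \<open>The full average at the reference point cancels, leaving the centred sample mean of the
  increments. These are what the Lipschitz constants control.\<close>

lemma vr_est_error:
  assumes "card S > 0" "N > 0"
  shows "vr_est h S x xt (avg_vec N h xt) - avg_vec N h x =
    (1 / real (card S)) *\<^sub>R sample_deviation (\<lambda>i. h i x - h i xt) N S"
  using assms
  by (simp add: vr_est_def avg_vec_def sample_deviation_def sum_subtractf scaleR_diff_right)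

lemma linear_columnvector: "linear (columnvector :: real^'n \<Rightarrow> real^1^'n)"
  by (rule linearI) (simp_all add: columnvector_def vec_eq_iff)

lemma columnvector_mult: "(columnvector y :: real^1^'n) *v u = u $ 1 *\<^sub>R y"
  by (simp add: vec_eq_iff columnvector_def matrix_vector_mult_def sum_1 mult.commute)

lemma norm_columnvector_mult: "norm ((columnvector y :: real^1^'n) *v u) = norm y * norm u"
  by (simp add: columnvector_mult norm_real)

text \<open>A d-by-1 matrix scales its one-dimensional argument into the direction \<open>y\<close>,
  and the vector 1 attains the norm; hence gradients fit the matrix bound.\<close>

lemma onorm_columnvector: "onorm ((*v) (columnvector y :: real^1^'n)) = norm y"
proof (rule antisym)
  show "onorm ((*v) (columnvector y :: real^1^'n)) \<le> norm y"
    by (rule onorm_le) (simp add: norm_columnvector_mult)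
  have "norm y * norm (1 :: real^1) \<le> onorm ((*v) (columnvector y :: real^1^'n)) * norm (1 :: real^1)"
    using onorm[OF matrix_vector_mul_bounded_linear, of "columnvector y :: real^1^'n" 1]
    by (simp add: norm_columnvector_mult)
  then show "norm y \<le> onorm ((*v) (columnvector y :: real^1^'n))" by simp
qed

lemma max_power_nonneg: "max (x ^ n) (y ^ n) = max x y ^ n" if "0 \<le> x" "0 \<le> y" for x y :: real
proof (cases "x \<le> y")
  case True
  with that power_mono[of x y n] show ?thesis by (simp add: max_absorb2)
next
  case False
  with that power_mono[of y x n] show ?thesis by (simp add: max_absorb1)
qed

theorem theorem5:
  fixes f :: "nat \<Rightarrow> real^'n \<Rightarrow> real"
    and gf :: "nat \<Rightarrow> real^'n \<Rightarrow> real^'n"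
    and Hf :: "nat \<Rightarrow> real^'n \<Rightarrow> real^'n^'n"
    and N :: nat and L0 L1 L2 \<alpha> \<beta> \<epsilon>1 \<zeta> :: real
    and xk xt sk :: "real^'n"
    and bg bH :: nat
  assumes N_pos: "N \<ge> 1"
    and grad: "\<And>i x. i < N \<Longrightarrow> (f i has_derivative (\<lambda>h. gf i x \<bullet> h)) (at x)"
    and hess: "\<And>i x. i < N \<Longrightarrow> (gf i has_derivative (\<lambda>h. Hf i x *v h)) (at x)"
    and F_bdd: "bdd_below (range (\<lambda>x. avg_vec N f x))"
    and lip0: "\<And>i x y. i < N \<Longrightarrow> \<bar>f i x - f i y\<bar> \<le> L0 * norm (x - y)"
    and lip1: "\<And>i x y. i < N \<Longrightarrow> norm (gf i x - gf i y) \<le> L1 * norm (x - y)"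
    and lip2: "\<And>i x y. i < N \<Longrightarrow> spec_norm (Hf i x - Hf i y) \<le> L2 * norm (x - y)"
    and alpha_pos: "\<alpha> > 0" and beta_pos: "\<beta> > 0" and eps_pos: "\<epsilon>1 > 0"
    and zeta: "0 < \<zeta>" "\<zeta> < 1"
    and bg_lt: "bg < N" and bH_lt: "bH < N"
  shows
    "(real bg \<ge> inverse (1 / real N + \<beta>^2 * max (norm sk ^ 4) (\<epsilon>1 ^ 4)
          / (64 * L1^2 * (norm (xk - xt))^2 * ln (2 * (real CARD('n) + 1) / \<zeta>)))
      \<longrightarrow> measure_pmf.prob (subset_sample N bg)
            {S. norm (vr_est gf S xk xt (avg_vec N gf xt) - avg_vec N gf xk)
                  \<le> \<beta> * max (norm sk ^ 2) (\<epsilon>1 ^ 2)} \<ge> 1 - \<zeta>)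
     \<and>
     (real bH \<ge> inverse (1 / real N + \<alpha>^2 * max (norm sk ^ 2) (\<epsilon>1 ^ 2)
          / (64 * L2^2 * (norm (xk - xt))^2 * ln (4 * real CARD('n) / \<zeta>)))
      \<longrightarrow> measure_pmf.prob (subset_sample N bH)
            {S. spec_norm (vr_est Hf S xk xt (avg_vec N Hf xt) - avg_vec N Hf xk)
                  \<le> \<alpha> * max (norm sk) \<epsilon>1} \<ge> 1 - \<zeta>)"
proof (intro conjI impI)
  let ?e = "\<beta> * max (norm sk ^ 2) (\<epsilon>1 ^ 2)"
  define \<sigma> where "\<sigma> = L1 * norm (xk - xt)"
  define a where "a i = gf i xk - gf i xt" for i
  assume size: "real bg \<ge> inverse (1 / real N + \<beta>^2 * max (norm sk ^ 4) (\<epsilon>1 ^ 4)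
          / (64 * L1^2 * (norm (xk - xt))^2 * ln (2 * (real CARD('n) + 1) / \<zeta>)))"
  have a_le: "norm (a i) \<le> \<sigma>" if "i < N" for i
    using lip1[OF that] by (simp add: a_def \<sigma>_def)
  have "max (norm sk ^ 4) (\<epsilon>1 ^ 4) = (max (norm sk ^ 2) (\<epsilon>1 ^ 2)) ^ 2"
    using max_power_nonneg[of "norm sk ^ 2" "\<epsilon>1 ^ 2" 2] by simp
  \<comment> \<open>The fourth powers are the square of the target accuracy, and d + 1 is the
    dilation dimension of a column.\<close>
  then have size': "real bg \<ge> inverse (1 / real N +
      ?e\<^sup>2 / (64 * \<sigma>\<^sup>2 * ln (2 * (real CARD('n) + real CARD(1)) / \<zeta>)))"
    using size by (simp add: \<sigma>_def power_mult_distrib mult.assoc)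
  show "measure_pmf.prob (subset_sample N bg)
      {S. norm (vr_est gf S xk xt (avg_vec N gf xt) - avg_vec N gf xk) \<le> ?e} \<ge> 1 - \<zeta>"
  proof (rule subset_sample_concentration[where a = "\<lambda>i. columnvector (a i) :: real^1^'n" and \<sigma> = \<sigma>,
        OF _ bg_lt _ _ zeta size'])
    show "norm (columnvector (a i) *v v) \<le> \<sigma> * norm v" if "i < N" for i and v :: "real^1"
      using a_le[OF that] by (simp add: norm_columnvector_mult mult_right_mono)
    \<comment> \<open>The sign comes from the Lipschitz bound at index 0, which exists since N is at
      least 1.\<close>
    show "\<sigma> \<ge> 0" using a_le[of 0] N_pos norm_ge_zero[of "a 0"] by linarith
    show "?e > 0" using beta_pos eps_pos by (simp add: less_max_iff_disj)
    show "norm (vr_est gf S xk xt (avg_vec N gf xt) - avg_vec N gf xk) \<le> ?e"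
      if "card S = bg" "0 < bg"
        "onorm ((*v) (sample_deviation (\<lambda>i. columnvector (a i) :: real^1^'n) N S)) \<le> real bg * ?e" for S
    proof -
      have "norm (sample_deviation a N S) \<le> real bg * ?e"
        using that(3) by (simp only: linear_sample_deviation[OF linear_columnvector, symmetric] onorm_columnvector)
      then show ?thesis
        using vr_est_error[of S N gf xk xt] that(1,2) N_pos
        by (simp add: a_def[abs_def] field_simps)
    qed
  qed
next
  let ?e = "\<alpha> * max (norm sk) \<epsilon>1"
  define \<sigma> where "\<sigma> = L2 * norm (xk - xt)"
  define a where "a i = Hf i xk - Hf i xt" for i
  assume size: "real bH \<ge> inverse (1 / real N + \<alpha>^2 * max (norm sk ^ 2) (\<epsilon>1 ^ 2)
          / (64 * L2^2 * (norm (xk - xt))^2 * ln (4 * real CARD('n) / \<zeta>)))"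
  have a_le: "onorm ((*v) (a i)) \<le> \<sigma>" if "i < N" for i
    using lip2[OF that] by (simp add: a_def \<sigma>_def spec_norm_def)
  \<comment> \<open>The constant 4d is 2 (d + d), from the dilation of a square matrix.\<close>
  have size': "real bH \<ge> inverse (1 / real N +
      ?e\<^sup>2 / (64 * \<sigma>\<^sup>2 * ln (2 * (real CARD('n) + real CARD('n)) / \<zeta>)))"
    using size max_power_nonneg[of "norm sk" \<epsilon>1 2] eps_pos
    by (simp add: \<sigma>_def power_mult_distrib mult.assoc)
  show "measure_pmf.prob (subset_sample N bH)
      {S. spec_norm (vr_est Hf S xk xt (avg_vec N Hf xt) - avg_vec N Hf xk) \<le> ?e} \<ge> 1 - \<zeta>"
  proof (rule subset_sample_concentration[where a = a and \<sigma> = \<sigma>, OF _ bH_lt _ _ zeta size'])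
    show "norm (a i *v v) \<le> \<sigma> * norm v" if "i < N" for i v
      using onorm[OF matrix_vector_mul_bounded_linear, of "a i" v] mult_right_mono[OF a_le[OF that], of "norm v"]
      by simp
    show "\<sigma> \<ge> 0"
      using a_le[of 0] N_pos onorm_pos_le[OF matrix_vector_mul_bounded_linear, of "a 0"] by linarith
    show "?e > 0" using alpha_pos eps_pos by (simp add: less_max_iff_disj)
    show "spec_norm (vr_est Hf S xk xt (avg_vec N Hf xt) - avg_vec N Hf xk) \<le> ?e"
      if "card S = bH" "0 < bH" "onorm ((*v) (sample_deviation a N S)) \<le> real bH * ?e" for S
    proof -
      have "spec_norm (vr_est Hf S xk xt (avg_vec N Hf xt) - avg_vec N Hf xk) =
          onorm (\<lambda>v. (1 / real bH) *\<^sub>R (sample_deviation a N S *v v))"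
        using vr_est_error[of S N Hf xk xt] that(1,2) N_pos
        by (simp add: spec_norm_def a_def[abs_def] scaleR_matrix_vector_assoc)
      also have "\<dots> = onorm ((*v) (sample_deviation a N S)) / real bH"
        by (subst onorm_scaleR[OF matrix_vector_mul_bounded_linear]) simp
      finally show ?thesis
        using that(2,3) by (simp add: pos_divide_le_eq mult.commute)
    qed
  qed
qed

end
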